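(* Let $\Phi=(G,\varphi)$ be a $\mathbb{T}$-gain graph whose underlying graph $G$ has vertex cover number $\tau(G)$ and maximum vertex degree $\Delta(G)$. Then $$\mathcal{E}(\Phi)\leq 2\tau(G)\sqrt{\Delta(G)}.$$
   Context: A $\mathbb{T}$-gain graph $\Phi=(G,\varphi)$ consists of a finite simple graph $G$ with vertex set $\{v_1,\dots,v_n\}$ and a map $\varphi$ assigning to each orientation $\overrightarrow{e_{p,q}}$ of each edge $v_pv_q$ of $G$ a value in $\mathbb{T}=\{z\in\mathbb{C}:|z|=1\}$, with $\varphi(\overrightarrow{e_{q,p}})=\varphi(\overrightarrow{e_{p,q}})^{-1}$. Its adjacency matrix $A(\Phi)$ is the Hermitian $n\times n$ matrix whose $(p,q)$ entry is $\varphi(\overrightarrow{e_{p,q}})$ if $v_p\sim v_q$ and $0$ otherwise. The energy $\mathcal{E}(\Phi)$ is the sum of absolute values of the eigenvalues of $A(\Phi)$. The vertex cover number $\tau(G)$ is the minimum size of a set of vertices meeting every edge. *)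

theory Defs
  imports
    Complex_Main
    "Graph_Theory.Pair_Digraph"
    "Jordan_Normal_Form.Spectral_Radius"
begin

text \<open>
  A finite simple graph is a \<open>pair_graph\<close>: finitely many vertices, and a symmetric, loop-free set of
  arcs. The arcs \<open>(a, b)\<close> and \<open>(b, a)\<close> are the two orientations of one edge.
\<close>

definition T_gain :: "'a pair_pre_digraph \<Rightarrow> ('a \<times> 'a \<Rightarrow> complex) \<Rightarrow> bool" where
  "T_gain G \<phi> \<longleftrightarrow>
    (\<forall>e \<in> parcs G. cmod (\<phi> e) = 1) \<and>
    (\<forall>a b. (a, b) \<in> parcs G \<longrightarrow> \<phi> (b, a) = inverse (\<phi> (a, b)))"

text \<open>
  The vertices are listed as \<open>v 0, \<dots>, v (n - 1)\<close>, following the 0-based matrix indices.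
\<close>

definition gain_adjacency ::
  "nat \<Rightarrow> (nat \<Rightarrow> 'a) \<Rightarrow> 'a pair_pre_digraph \<Rightarrow> ('a \<times> 'a \<Rightarrow> complex) \<Rightarrow> complex mat" where
  "gain_adjacency n v G \<phi> =
    mat n n (\<lambda>(p, q). if (v p, v q) \<in> parcs G then \<phi> (v p, v q) else 0)"

text \<open>
  The energy counts every eigenvalue with its multiplicity, that is, its order as a root of the
  characteristic polynomial.
\<close>

definition gain_energy ::
  "nat \<Rightarrow> (nat \<Rightarrow> 'a) \<Rightarrow> 'a pair_pre_digraph \<Rightarrow> ('a \<times> 'a \<Rightarrow> complex) \<Rightarrow> real" where
  "gain_energy n v G \<phi> =
    (let A = gain_adjacency n v G \<phi>
     in \<Sum>\<mu> \<in> spectrum A. real (order \<mu> (char_poly A)) * cmod \<mu>)"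

definition vertex_cover :: "'a pair_pre_digraph \<Rightarrow> 'a set \<Rightarrow> bool" where
  "vertex_cover G S \<longleftrightarrow> S \<subseteq> pverts G \<and> (\<forall>(a, b) \<in> parcs G. a \<in> S \<or> b \<in> S)"

definition vertex_cover_number :: "'a pair_pre_digraph \<Rightarrow> nat" where
  "vertex_cover_number G = Min (card ` {S. vertex_cover G S})"

text \<open>
  Since the arcs are symmetric, the out-degree of a vertex is the number of its neighbours. The
  inserted 0 only matters for the graph without vertices.
\<close>

definition max_degree :: "'a pair_pre_digraph \<Rightarrow> nat" where
  "max_degree G = Max (insert 0 (out_degree (with_proj G) ` pverts G))"

end

theory Submission
  imports Defs "HOL-Analysis.L2_Norm"
begin

text \<open>
  Schur triangularisation \<open>A = U B U\<^sup>*\<close> with \<open>U\<close> unitary puts the eigenvalues on the diagonal of \<open>B\<close>.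
  If \<open>D\<close> is the diagonal matrix of the phases that turn each \<open>B\<^sub>i\<^sub>i\<close> into its modulus, the energy
  is \<open>tr (A M)\<close> for the unitary matrix \<open>M = U D U\<^sup>*\<close>. Every nonzero entry of \<open>A\<close> lies in a row or in
  a column of a vertex of the cover. By Cauchy--Schwarz each such row or column contributes at most
  \<open>sqrt \<Delta>\<close> to the trace, because it has at most \<open>\<Delta>\<close> nonzero entries, all of modulus 1, while the rows
  and columns of \<open>M\<close> are unit vectors.
\<close>

section \<open>Conjugate transposes\<close>

lemma mat_adjoint_dims [simp]:
  "dim_row (mat_adjoint A) = dim_col A" "dim_col (mat_adjoint A) = dim_row A"
  by (simp_all add: mat_adjoint_def)

lemma mat_adjoint_carrier [simp]:
  "A \<in> carrier_mat m n \<Longrightarrow> mat_adjoint A \<in> carrier_mat n m"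
  by (intro carrier_matI) auto

lemma mat_adjoint_index [simp]:
  assumes "i < dim_col A" "j < dim_row A"
  shows "mat_adjoint A $$ (i, j) = conjugate (A $$ (j, i))"
  using assms by (simp add: mat_adjoint_def mat_of_rows_index)

text \<open>Reduces the block formula \<open>mat_adjoint_four_block\<close> to the ones for
  \<open>map_mat\<close> and \<open>transpose_mat\<close>.\<close>

lemma mat_adjoint_conv_transpose: "mat_adjoint A = transpose_mat (map_mat conjugate A)"
  by (rule eq_matI) simp_all

lemma mat_adjoint_mult:
  fixes A B :: "complex mat"
  assumes "A \<in> carrier_mat m n" "B \<in> carrier_mat n k"
  shows "mat_adjoint (A * B) = mat_adjoint B * mat_adjoint A"
proof (rule eq_matI)
  fix i j
  assume "i < dim_row (mat_adjoint B * mat_adjoint A)" "j < dim_col (mat_adjoint B * mat_adjoint A)"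
  then show "mat_adjoint (A * B) $$ (i, j) = (mat_adjoint B * mat_adjoint A) $$ (i, j)"
    using assms by (simp add: scalar_prod_def mult.commute)
qed (use assms in simp_all)

lemma mat_adjoint_four_block:
  assumes "A \<in> carrier_mat m n" "B \<in> carrier_mat m l" "C \<in> carrier_mat k n" "D \<in> carrier_mat k l"
  shows "mat_adjoint (four_block_mat A B C D)
    = four_block_mat (mat_adjoint A) (mat_adjoint C) (mat_adjoint B) (mat_adjoint D)"
  unfolding mat_adjoint_conv_transpose map_four_block_mat[OF assms]
  using assms by (intro transpose_four_block_mat) simp_all

section \<open>Unitary matrices\<close>

text \<open>For square matrices a left inverse is also a right inverse, so this one-sided condition
  yields \<open>unitary_right\<close>.\<close>

definition unitary :: "nat \<Rightarrow> complex mat \<Rightarrow> bool" where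
  "unitary n U \<longleftrightarrow> U \<in> carrier_mat n n \<and> mat_adjoint U * U = 1\<^sub>m n"

lemma unitary_carrier: "unitary n U \<Longrightarrow> U \<in> carrier_mat n n"
  by (simp add: unitary_def)

lemma unitary_left: "unitary n U \<Longrightarrow> mat_adjoint U * U = 1\<^sub>m n"
  by (simp add: unitary_def)

lemma unitary_right: "unitary n U \<Longrightarrow> U * mat_adjoint U = 1\<^sub>m n"
  by (auto simp: unitary_def intro: mat_mult_left_right_inverse)

lemma mult_adjoint_cancel:
  assumes "unitary n U" "A \<in> carrier_mat n k"
  shows "mat_adjoint U * (U * A) = A" "U * (mat_adjoint U * A) = A"
proof -
  note U = unitary_carrier[OF assms(1)]
  have U': "mat_adjoint U \<in> carrier_mat n n"
    using U by simp
  show "mat_adjoint U * (U * A) = A"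
    using assms(2) by (simp add: assoc_mult_mat[OF U' U assms(2), symmetric] unitary_left[OF assms(1)])
  show "U * (mat_adjoint U * A) = A"
    using assms(2) by (simp add: assoc_mult_mat[OF U U' assms(2), symmetric] unitary_right[OF assms(1)])
qed

lemma unitary_adjoint: "unitary n U \<Longrightarrow> unitary n (mat_adjoint U)"
proof -
  assume U: "unitary n U"
  have "mat_adjoint (mat_adjoint U) = U"
    by (rule eq_matI) auto
  then show ?thesis
    using unitary_right[OF U] unitary_carrier[OF U] by (simp add: unitary_def)
qed

lemma unitary_mult:
  assumes U: "unitary n U" and V: "unitary n V"
  shows "unitary n (U * V)"
proof -
  note c = unitary_carrier[OF U] unitary_carrier[OF V]
  have "mat_adjoint (U * V) * (U * V) = mat_adjoint V * (mat_adjoint U * (U * V))"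
    using c by (simp add: mat_adjoint_mult[OF c] assoc_mult_mat[of _ n n _ n _ n])
  then show ?thesis
    using c by (simp add: unitary_def mult_adjoint_cancel(1)[OF U c(2)] unitary_left[OF V])
qed

text \<open>The squared norm of column \<open>j\<close> is the diagonal entry \<open>(j, j)\<close>
  of \<open>mat_adjoint U * U\<close>.\<close>

lemma unitary_col_norm:
  assumes U: "unitary n U" and j: "j < n"
  shows "(\<Sum>i<n. (cmod (U $$ (i, j)))\<^sup>2) = 1"
proof -
  have c: "dim_row U = n" "dim_col U = n"
    using unitary_carrier[OF U] by auto
  have "complex_of_real (\<Sum>i<n. (cmod (U $$ (i, j)))\<^sup>2) = (mat_adjoint U * U) $$ (j, j)"
    using c j by (simp add: scalar_prod_def complex_norm_square mult.commute lessThan_atLeast0 del: of_real_power)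
  also have "\<dots> = 1"
    using j by (simp add: unitary_left[OF U])
  finally show ?thesis
    using of_real_eq_1_iff by blast
qed

text \<open>Up to conjugation, the rows of \<open>U\<close> are the columns of its adjoint, which is
  unitary as well.\<close>

lemma unitary_row_norm:
  assumes "unitary n U" "i < n"
  shows "(\<Sum>j<n. (cmod (U $$ (i, j)))\<^sup>2) = 1"
  using unitary_col_norm[OF unitary_adjoint[OF assms(1)] assms(2)] unitary_carrier[OF assms(1)] assms(2)
  by simp

section \<open>Unitary triangularisation\<close>

text \<open>Complete \<open>v\<close> to a basis, orthogonalise it by Gram-Schmidt and normalise.
  The scalar \<open>c\<close> absorbs the normalisation of \<open>v\<close>.\<close>

lemma unitary_with_first_col:
  assumes v: "v \<in> carrier_vec n" and v0: "v \<noteq> 0\<^sub>v n"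
  obtains W c where "unitary n W" "col W 0 = c \<cdot>\<^sub>v v"
proof -
  interpret cof_vec_space n "TYPE(complex)" .
  define b where "b = basis_completion v"
  define ws where "ws = gram_schmidt n b"
  note b = basis_completion[OF v v0, folded b_def]
  have n: "0 < n"
    using v v0 by (cases n) auto
  have ws: "corthogonal ws" "set ws \<subseteq> carrier_vec n" "length ws = n"
    using gram_schmidt_result[OF b(2,4,5) ws_def] b(6) by auto
  \<comment> \<open>Gram-Schmidt keeps the head of its list, so \<open>v\<close> survives as the
    first orthogonal vector.\<close>
  have "b = v # tl b"
    using b(6,7) n by (cases b) auto
  then have "hd ws = v"
    unfolding ws_def using gram_schmidt_hd[OF v] by metis
  then have ws0: "ws ! 0 = v"
    using ws(3) n by (cases ws) auto
  have wsc: "ws ! j \<in> carrier_vec n" if "j < n" for j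
    using ws(2,3) that by (metis nth_mem subsetD)
  \<comment> \<open>The vectors in \<open>ws\<close> are orthogonal but not of unit length;
    \<open>r j\<close> is the Euclidean norm of \<open>ws ! j\<close>, as a complex number. Being
    real, it is unaffected by conjugation.\<close>
  define r where "r j = complex_of_real (sqrt (Re (ws ! j \<bullet>c ws ! j)))" for j
  define W where "W = mat n n (\<lambda>(i, j). ws ! j $ i / r j)"
  have rr: "r j * r j = ws ! j \<bullet>c ws ! j" and r0: "r j \<noteq> 0" if j: "j < n" for j
  proof -
    have "ws ! j \<bullet>c ws ! j \<ge> 0"
      by (rule conjugate_square_ge_0_vec)
    then have *: "ws ! j \<bullet>c ws ! j = complex_of_real (Re (ws ! j \<bullet>c ws ! j))" "Re (ws ! j \<bullet>c ws ! j) \<ge> 0"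
      by (auto simp: complex_eq_iff less_eq_complex_def)
    then show "r j * r j = ws ! j \<bullet>c ws ! j"
      unfolding r_def by (metis of_real_mult real_sqrt_mult_self abs_of_nonneg)
    moreover have "ws ! j \<bullet>c ws ! j \<noteq> 0"
      using corthogonalD[OF ws(1), of j j] j ws(3) by simp
    ultimately show "r j \<noteq> 0"
      by auto
  qed
  have W: "W \<in> carrier_mat n n"
    by (simp add: W_def)
  have "mat_adjoint W * W = 1\<^sub>m n"
  proof (rule eq_matI)
    fix i j assume "i < dim_row (1\<^sub>m n :: complex mat)" "j < dim_col (1\<^sub>m n :: complex mat)"
    then have ij: "i < n" "j < n"
      by auto
    have "(mat_adjoint W * W) $$ (i, j) = (\<Sum>k = 0..<n. ws ! j $ k * cnj (ws ! i $ k)) / (r j * r i)"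
      using ij W by (simp add: W_def scalar_prod_def r_def mult.commute flip: sum_divide_distrib)
    also have "\<dots> = ws ! j \<bullet>c ws ! i / (r j * r i)"
      using wsc[OF ij(1)] by (simp add: scalar_prod_def)
    also have "\<dots> = 1\<^sub>m n $$ (i, j)"
      using ij corthogonalD[OF ws(1), of j i] ws(3) rr[OF ij(1)] r0[OF ij(1)] by auto
    finally show "(mat_adjoint W * W) $$ (i, j) = 1\<^sub>m n $$ (i, j)" .
  qed (use W in auto)
  then have "unitary n W"
    using W by (simp add: unitary_def)
  moreover have "col W 0 = (1 / r 0) \<cdot>\<^sub>v v"
    using n v ws0 by (intro eq_vecI) (auto simp: W_def)
  ultimately show ?thesis
    using that by blast
qed

text \<open>Deflation: in an orthonormal basis that starts with an eigenvector, the first column of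
  the matrix vanishes below the corner. The induction hypothesis then triangularises the remaining
  block.\<close>

lemma unitary_schur:
  fixes A :: "complex mat"
  assumes "A \<in> carrier_mat n n"
  shows "\<exists>U. unitary n U \<and> upper_triangular (mat_adjoint U * A * U)"
  using assms
proof (induction n arbitrary: A)
  case 0
  then show ?case
    by (intro exI[of _ "1\<^sub>m 0"]) (auto simp: unitary_def intro: eq_matI)
next
  case (Suc n)
  let ?N = "Suc n"
  obtain e v where ev: "eigenvector A v e"
    using spectrum_non_empty[OF Suc.prems] by (auto simp: spectrum_def eigenvalue_def)
  then have v: "v \<in> carrier_vec ?N" "v \<noteq> 0\<^sub>v ?N" "A *\<^sub>v v = e \<cdot>\<^sub>v v"
    using Suc.prems by (auto simp: eigenvector_def)
  obtain W c where W: "unitary ?N W" and W0: "col W 0 = c \<cdot>\<^sub>v v"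
    using unitary_with_first_col[OF v(1,2)] .
  note Wc = unitary_carrier[OF W]
  define A' where "A' = mat_adjoint W * (A * W)"
  have A': "A' \<in> carrier_mat ?N ?N"
    unfolding A'_def using Wc Suc.prems by (intro mult_carrier_mat[of _ ?N ?N]) auto
  have "A *\<^sub>v col W 0 = e \<cdot>\<^sub>v col W 0"
    using v Suc.prems by (simp add: W0 mult_mat_vec[of _ ?N ?N] smult_smult_assoc mult.commute)
  then have "col (A * W) 0 = e \<cdot>\<^sub>v col W 0"
    using Wc Suc.prems by (metis col_mult2 zero_less_Suc)
  \<comment> \<open>The first column of \<open>A * W\<close> is \<open>e\<close> times that of
    \<open>W\<close>, and the adjoint of \<open>W\<close> sends the latter to the first unit
    vector.\<close>
  then have "col A' 0 = e \<cdot>\<^sub>v col (mat_adjoint W * W) 0"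
    using Wc Suc.prems unfolding A'_def
    by (subst (1 2) col_mult2[where nr = ?N and n = ?N and nc = ?N]) (auto simp: mult_mat_vec[of _ ?N ?N])
  then have A'0: "col A' 0 = e \<cdot>\<^sub>v unit_vec ?N 0"
    by (simp add: unitary_left[OF W])
  obtain B1 B2 B3 B4 where spl: "split_block A' 1 1 = (B1, B2, B3, B4)"
    by (cases "split_block A' 1 1")
  have B: "B1 \<in> carrier_mat 1 1" "B2 \<in> carrier_mat 1 n" "B3 \<in> carrier_mat n 1" "B4 \<in> carrier_mat n n"
    and A'B: "A' = four_block_mat B1 B2 B3 B4"
    using split_block[OF spl, of n n] A' by auto
  have "B3 = 0\<^sub>m n 1"
  proof (rule eq_matI)
    fix i j assume "i < dim_row (0\<^sub>m n 1 :: complex mat)" "j < dim_col (0\<^sub>m n 1 :: complex mat)"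
    then have ij: "i < n" "j = 0"
      by auto
    have "B3 $$ (i, 0) = A' $$ (Suc i, 0)"
      using ij B by (simp add: A'B)
    also have "\<dots> = col A' 0 $ Suc i"
      using A' ij by simp
    also have "\<dots> = 0"
      using ij by (simp add: A'0)
    finally show "B3 $$ (i, j) = 0\<^sub>m n 1 $$ (i, j)"
      using ij by simp
  qed (use B in auto)
  note A'B = A'B[unfolded this]
  obtain V where V: "unitary n V" and ut: "upper_triangular (mat_adjoint V * B4 * V)"
    using Suc.IH[OF B(4)] by auto
  note Vc = unitary_carrier[OF V]
  \<comment> \<open>Bordering \<open>V\<close> with a 1 fixes the first basis vector, so conjugation
    by \<open>P\<close> preserves the zeros below the corner.\<close>
  define P where "P = four_block_mat (1\<^sub>m 1) (0\<^sub>m 1 n) (0\<^sub>m n 1) V"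
  have Padj: "mat_adjoint P = four_block_mat (1\<^sub>m 1) (0\<^sub>m 1 n) (0\<^sub>m n 1) (mat_adjoint V)"
  proof -
    have "mat_adjoint (0\<^sub>m a b :: complex mat) = 0\<^sub>m b a" for a b
      by (rule eq_matI) auto
    then show ?thesis
      unfolding P_def using Vc by (subst mat_adjoint_four_block[of _ 1 1 _ n _ n]) auto
  qed
  have Pc: "P \<in> carrier_mat ?N ?N"
    using Vc by (auto simp: P_def)
  have P: "unitary ?N P"
  proof -
    have "mat_adjoint P * P = four_block_mat (1\<^sub>m 1) (0\<^sub>m 1 n) (0\<^sub>m n 1) (1\<^sub>m n)"
      unfolding Padj unfolding P_def using Vc
      by (subst mult_four_block_mat[of _ 1 1 _ n _ n _ _ 1 _ n]) (auto simp: unitary_left[OF V])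
    then show ?thesis
      using Pc by (simp add: unitary_def)
  qed
  have "mat_adjoint P * (A' * P)
      = four_block_mat B1 (B2 * V) (0\<^sub>m n 1) (mat_adjoint V * (B4 * V))"
    unfolding Padj A'B unfolding P_def using Vc B
    by (subst mult_four_block_mat[of _ 1 1 _ n _ n _ _ 1 _ n],
        auto, subst mult_four_block_mat[of _ 1 1 _ n _ n _ _ 1 _ n], auto)
  moreover have "upper_triangular \<dots>"
    using ut B Vc
    by (intro upper_triangular_four_block)
      (auto simp: upper_triangular_def assoc_mult_mat[of _ n n _ n _ n])
  \<comment> \<open>The two successive conjugations are a single one by \<open>W * P\<close>, the
    witness for \<open>A\<close>.\<close>
  moreover have "mat_adjoint P * (A' * P) = mat_adjoint (W * P) * A * (W * P)"
  proof -
    have c: "mat_adjoint P \<in> carrier_mat ?N ?N" "mat_adjoint W \<in> carrier_mat ?N ?N"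
      using Pc Wc by auto
    show ?thesis
      using Suc.prems Pc Wc c mult_carrier_mat[OF Suc.prems Wc] mult_carrier_mat[OF Wc Pc]
        mult_carrier_mat[OF c] mult_carrier_mat[OF c(2) Suc.prems]
      by (simp add: mat_adjoint_mult[OF Wc Pc] A'_def assoc_mult_mat[of _ ?N ?N _ ?N _ ?N])
  qed
  ultimately show ?case
    using unitary_mult[OF W P] by metis
qed

section \<open>The energy as a trace\<close>

text \<open>\<open>S\<close> may exceed \<open>set xs\<close> so that it can stay fixed in the
  induction while the list gets shorter.\<close>

lemma sum_count_list:
  fixes f :: "'b \<Rightarrow> real"
  assumes "finite S" "set xs \<subseteq> S"
  shows "(\<Sum>x\<in>S. real (count_list xs x) * f x) = sum_list (map f xs)"
  using assms(2)
proof (induction xs)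
  case (Cons y xs)
  have "(\<Sum>x\<in>S. real (count_list (y # xs) x) * f x)
      = (\<Sum>x\<in>S. (if y = x then f x else 0) + real (count_list xs x) * f x)"
    by (intro sum.cong) (auto simp: algebra_simps)
  then show ?case
    using Cons assms(1) by (simp add: sum.distrib)
qed simp

text \<open>The characteristic polynomial is a product of linear factors, one for each diagonal
  entry of \<open>B\<close>. Orders add over products, so the order of a root counts its occurrences
  on the diagonal.\<close>

lemma sum_order_char_poly:
  fixes A B :: "complex mat" and f :: "complex \<Rightarrow> real"
  assumes A: "A \<in> carrier_mat n n" and B: "B \<in> carrier_mat n n"
    and sim: "similar_mat A B" and ut: "upper_triangular B"
  shows "(\<Sum>\<mu>\<in>spectrum A. real (order \<mu> (char_poly A)) * f \<mu>) = (\<Sum>i<n. f (B $$ (i, i)))"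
proof -
  let ?d = "diag_mat B"
  have cp: "char_poly A = (\<Prod>a\<leftarrow>?d. [:- a, 1:])"
    using char_poly_similar[OF sim] char_poly_upper_triangular[OF B ut] by simp
  have "order \<mu> (char_poly A) = count_list ?d \<mu>" for \<mu>
  proof -
    have "order \<mu> (char_poly A) = (\<Sum>a\<leftarrow>?d. if a = \<mu> then 1 else 0)"
      unfolding cp by (subst order_prod_list) (auto simp: o_def order_linear' cong: if_cong)
    \<comment> \<open>The variable \<open>ds\<close> stands for the diagonal, to allow induction on
      an arbitrary list.\<close>
    also have "\<dots> = count_list ds \<mu>" if "ds = ?d" for ds
      unfolding that[symmetric] by (induction ds) auto
    finally show ?thesis
      by simp
  qed
  moreover have "spectrum A = set ?d"
    unfolding spectrum_root_char_poly[OF A] cp by (auto simp: poly_prod_list)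
  ultimately have "(\<Sum>\<mu>\<in>spectrum A. real (order \<mu> (char_poly A)) * f \<mu>)
      = (\<Sum>\<mu>\<in>set ?d. real (count_list ?d \<mu>) * f \<mu>)"
    by simp
  also have "\<dots> = sum_list (map f ?d)"
    by (rule sum_count_list) auto
  also have "\<dots> = (\<Sum>i<n. f (B $$ (i, i)))"
    using B by (simp add: diag_mat_def o_def interv_sum_list_conv_sum_set_nat lessThan_atLeast0)
  finally show ?thesis .
qed

text \<open>By cyclicity, the trace of \<open>A * M\<close> is that of \<open>B * D\<close>. As
  \<open>D\<close> is diagonal, only the diagonal of \<open>B\<close> enters, so a triangular
  \<open>B\<close> serves as well as a diagonal one.\<close>

lemma energy_eq_trace:
  fixes A :: "complex mat"
  assumes A: "A \<in> carrier_mat n n"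
  obtains M where "unitary n M"
    "complex_of_real (\<Sum>\<mu>\<in>spectrum A. real (order \<mu> (char_poly A)) * cmod \<mu>)
      = (\<Sum>p<n. \<Sum>q<n. A $$ (p, q) * M $$ (q, p))"
proof -
  obtain U where U: "unitary n U" and ut: "upper_triangular (mat_adjoint U * A * U)"
    using unitary_schur[OF A] by auto
  note Uc = unitary_carrier[OF U]
  have Uc': "mat_adjoint U \<in> carrier_mat n n"
    using Uc by simp
  define B where "B = mat_adjoint U * A * U"
  have B: "B \<in> carrier_mat n n"
    unfolding B_def using A Uc Uc' by (intro mult_carrier_mat[of _ n n]) auto
  have "A = U * B * mat_adjoint U"
  proof -
    have "B = mat_adjoint U * (A * U)"
      using A Uc Uc' by (simp add: B_def assoc_mult_mat[of _ n n _ n _ n])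
    then have "U * B * mat_adjoint U = A * U * mat_adjoint U"
      using mult_adjoint_cancel(2)[OF U mult_carrier_mat[OF A Uc]] by simp
    also have "\<dots> = A"
      using A Uc Uc' by (simp add: assoc_mult_mat[of _ n n _ n _ n] unitary_right[OF U])
    finally show ?thesis ..
  qed
  then have "similar_mat A B"
    using similar_mat_witI[OF unitary_right[OF U] unitary_left[OF U] _ A B Uc Uc']
    by (auto simp: similar_mat_def)
  then have energy: "(\<Sum>\<mu>\<in>spectrum A. real (order \<mu> (char_poly A)) * cmod \<mu>) = (\<Sum>i<n. cmod (B $$ (i, i)))"
    using sum_order_char_poly[OF A B] ut by (simp add: B_def)
  \<comment> \<open>At a zero entry \<open>sgn\<close> would give 0; the value 1 keeps every phase
    of modulus 1, hence \<open>D\<close> unitary.\<close>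
  define s where "s i = (if B $$ (i, i) = 0 then 1 else cnj (sgn (B $$ (i, i))))" for i
  have s1: "cnj (s i) * s i = 1" for i
    by (simp add: s_def mult.commute flip: complex_norm_square) (simp add: norm_sgn)
  have sB: "complex_of_real (cmod (B $$ (i, i))) = s i * B $$ (i, i)" for i
    by (auto simp: s_def sgn_eq mult.commute power2_eq_square simp flip: complex_norm_square)
  define D where "D = mat n n (\<lambda>(i, j). if i = j then s i else 0)"
  have D: "unitary n D"
    unfolding unitary_def
  proof
    show "mat_adjoint D * D = 1\<^sub>m n"
      by (rule eq_matI) (auto simp: D_def scalar_prod_def s1 if_distrib[of cnj] if_distrib[of "\<lambda>x. x * _"] if_distrib[of "(*) _"] cong: if_cong)
  qed (simp add: D_def)
  note Dc = unitary_carrier[OF D]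
  define M where "M = U * (D * mat_adjoint U)"
  have unitary_M: "unitary n M"
    unfolding M_def using U D by (intro unitary_mult unitary_adjoint)
  have M: "M $$ (q, p) = (\<Sum>i<n. U $$ (q, i) * (s i * cnj (U $$ (p, i))))" if "p < n" "q < n" for p q
  proof -
    have "(D * mat_adjoint U) $$ (i, p) = s i * cnj (U $$ (p, i))" if "i < n" for i
      using that \<open>p < n\<close> Uc by (simp add: D_def scalar_prod_def if_distrib[of "\<lambda>x. x * _"] cong: if_cong)
    then show ?thesis
      using that Uc Dc by (simp add: M_def scalar_prod_def lessThan_atLeast0)
  qed
  have Bii: "B $$ (i, i) = (\<Sum>p<n. \<Sum>q<n. cnj (U $$ (p, i)) * A $$ (p, q) * U $$ (q, i))" if "i < n" for i
    using that A Uc unfolding B_def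
    by (simp add: scalar_prod_def lessThan_atLeast0 sum_distrib_right, subst sum.swap) simp
  have "complex_of_real (\<Sum>i<n. cmod (B $$ (i, i)))
      = (\<Sum>i<n. s i * B $$ (i, i))"
    by (simp only: of_real_sum sB)
  also have "\<dots> = (\<Sum>i<n. \<Sum>p<n. \<Sum>q<n. A $$ (p, q) * (U $$ (q, i) * (s i * cnj (U $$ (p, i)))))"
    by (intro sum.cong refl) (simp add: Bii sum_distrib_left ac_simps)
  \<comment> \<open>With the sum over \<open>i\<close> innermost, the factors other than
    \<open>A $$ (p, q)\<close> add up to the entry \<open>M $$ (q, p)\<close>.\<close>
  also have "\<dots> = (\<Sum>p<n. \<Sum>q<n. \<Sum>i<n. A $$ (p, q) * (U $$ (q, i) * (s i * cnj (U $$ (p, i)))))"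
    by (subst sum.swap, rule sum.cong[OF refl], rule sum.swap)
  also have "\<dots> = (\<Sum>p<n. \<Sum>q<n. A $$ (p, q) * M $$ (q, p))"
    by (simp add: M sum_distrib_left)
  finally show ?thesis
    using that[OF unitary_M] energy by simp
qed

section \<open>Bounding the trace by a cover\<close>

text \<open>Cauchy-Schwarz, for a row or column \<open>f\<close> of the matrix against a unit column
  or row \<open>g\<close> of \<open>M\<close>.\<close>

lemma sum_norm_mult_le:
  fixes f g :: "'b \<Rightarrow> complex"
  assumes "(\<Sum>i\<in>I. (cmod (f i))\<^sup>2) \<le> d" "(\<Sum>i\<in>I. (cmod (g i))\<^sup>2) \<le> 1"
  shows "(\<Sum>i\<in>I. cmod (f i * g i)) \<le> sqrt d"
proof -
  have d: "0 \<le> d"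
    using assms(1) by (meson order_trans sum_nonneg zero_le_power2)
  have "(\<Sum>i\<in>I. cmod (f i * g i)) \<le> L2_set (\<lambda>i. cmod (f i)) I * L2_set (\<lambda>i. cmod (g i)) I"
    using L2_set_mult_ineq[of "\<lambda>i. cmod (f i)" "\<lambda>i. cmod (g i)" I] by (simp add: norm_mult)
  also have "\<dots> \<le> sqrt d * 1"
    using assms d by (intro mult_mono) (auto simp: L2_set_def sum_nonneg)
  finally show ?thesis
    by simp
qed

text \<open>The factor 2 arises because each index of \<open>S\<close> is charged once for its row
  and once for its column.\<close>

lemma energy_le_cover:
  fixes A :: "complex mat"
  assumes A: "A \<in> carrier_mat n n" and S: "S \<subseteq> {..<n}"
    and cover: "\<And>p q. p < n \<Longrightarrow> q < n \<Longrightarrow> A $$ (p, q) \<noteq> 0 \<Longrightarrow> p \<in> S \<or> q \<in> S"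
    and row: "\<And>p. p < n \<Longrightarrow> (\<Sum>q<n. (cmod (A $$ (p, q)))\<^sup>2) \<le> d"
    and col: "\<And>q. q < n \<Longrightarrow> (\<Sum>p<n. (cmod (A $$ (p, q)))\<^sup>2) \<le> d"
  shows "(\<Sum>\<mu>\<in>spectrum A. real (order \<mu> (char_poly A)) * cmod \<mu>) \<le> 2 * real (card S) * sqrt d"
    (is "?E \<le> _")
proof -
  obtain M where M: "unitary n M"
    and E: "complex_of_real ?E = (\<Sum>p<n. \<Sum>q<n. A $$ (p, q) * M $$ (q, p))"
    using energy_eq_trace[OF A] by blast
  define h where "h p q = cmod (A $$ (p, q) * M $$ (q, p))" for p q
  have fin: "finite S"
    using S finite_subset by blast
  have "?E \<le> cmod (complex_of_real ?E)"
    by (simp only: norm_of_real abs_ge_self)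
  also have "\<dots> \<le> (\<Sum>p<n. \<Sum>q<n. h p q)"
    unfolding E h_def by (intro sum_norm_le norm_sum)
  \<comment> \<open>A term with both indices in \<open>S\<close> is counted twice, which is harmless
    since \<open>h\<close> is nonnegative; a term with neither vanishes by
    \<open>cover\<close>.\<close>
  also have "\<dots> \<le> (\<Sum>p<n. \<Sum>q<n. (if p \<in> S then h p q else 0) + (if q \<in> S then h p q else 0))"
    using cover by (intro sum_mono) (auto simp: h_def)
  also have "\<dots> = (\<Sum>p<n. \<Sum>q<n. if p \<in> S then h p q else 0) + (\<Sum>q<n. \<Sum>p<n. if q \<in> S then h p q else 0)"
    by (simp add: sum.distrib) (rule sum.swap)
  also have "\<dots> = (\<Sum>p<n. if p \<in> S then \<Sum>q<n. h p q else 0) + (\<Sum>q<n. if q \<in> S then \<Sum>p<n. h p q else 0)"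
    by (intro arg_cong2[where f = "(+)"] sum.cong) auto
  also have "\<dots> = (\<Sum>p\<in>S. \<Sum>q<n. h p q) + (\<Sum>q\<in>S. \<Sum>p<n. h p q)"
    using S by (simp add: Int_absorb1 flip: sum.inter_restrict)
  \<comment> \<open>Row \<open>p\<close> of \<open>A\<close> meets column \<open>p\<close> of
    \<open>M\<close> in the first sum; column \<open>q\<close> of \<open>A\<close> meets row
    \<open>q\<close> of \<open>M\<close> in the second.\<close>
  also have "\<dots> \<le> (\<Sum>p\<in>S. sqrt d) + (\<Sum>q\<in>S. sqrt d)"
    unfolding h_def using S unitary_col_norm[OF M] unitary_row_norm[OF M]
    by (intro add_mono sum_mono sum_norm_mult_le row col) auto
  also have "\<dots> = 2 * real (card S) * sqrt d"
    by simp
  finally show ?thesis .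
qed

section \<open>Application to gain graphs\<close>

theorem theorem5p1:
  fixes G :: "'a pair_pre_digraph" and \<phi> :: "'a \<times> 'a \<Rightarrow> complex"
    and n :: nat and v :: "nat \<Rightarrow> 'a"
  assumes "pair_graph G"
    and "bij_betw v {..<n} (pverts G)"
    and "T_gain G \<phi>"
  shows "gain_energy n v G \<phi> \<le> 2 * real (vertex_cover_number G) * sqrt (real (max_degree G))"
proof -
  have G: "pair_pseudo_graph G"
    by (rule pair_graph.axioms(2)[OF assms(1)])
  note fin = pair_pseudo_graph.axioms(1)[OF G]
  note wf = pair_fin_digraph.axioms(1)[OF fin]
  note pair_finite_verts = pair_fin_digraph.pair_finite_verts[OF fin]
    and pair_sym_arcs = pair_sym_digraph.pair_sym_arcs[OF pair_pseudo_graph.axioms(2)[OF G]]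
    and in_arcsD1 = pair_wf_digraph.in_arcsD1[OF wf]
    and in_arcsD2 = pair_wf_digraph.in_arcsD2[OF wf]
  have inj: "inj_on v {..<n}" and ran: "v ` {..<n} = pverts G"
    using assms(2) by (auto simp: bij_betw_def)
  let ?A = "gain_adjacency n v G \<phi>"
  have arc_sym: "(b, a) \<in> parcs G \<longleftrightarrow> (a, b) \<in> parcs G" for a b
    using pair_sym_arcs by (auto simp: symmetric_def sym_def)
  \<comment> \<open>Gains have modulus 1, so the squared norm of a row counts the neighbours of its
    vertex.\<close>
  have norm_A: "(cmod (?A $$ (p, q)))\<^sup>2 = (if (v p, v q) \<in> parcs G then 1 else 0)" if "p < n" "q < n" for p q
    using that assms(3) by (auto simp: gain_adjacency_def T_gain_def)
  have deg: "(\<Sum>q<n. if (v p, v q) \<in> parcs G then 1 else 0 :: real) \<le> max_degree G" if p: "p < n" for p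
  proof -
    \<comment> \<open>An arc out of \<open>v p\<close> is determined by the index of its head, and
      every head has an index because \<open>v\<close> enumerates the vertices.\<close>
    have "bij_betw (\<lambda>q. (v p, v q)) {q \<in> {..<n}. (v p, v q) \<in> parcs G} (out_arcs (with_proj G) (v p))"
      unfolding bij_betw_def
    proof
      show "inj_on (\<lambda>q. (v p, v q)) {q \<in> {..<n}. (v p, v q) \<in> parcs G}"
        using inj by (auto simp: inj_on_def)
      have "b \<in> v ` {..<n}" if "(a, b) \<in> parcs G" for a b
        using that in_arcsD2 ran by simp
      then show "(\<lambda>q. (v p, v q)) ` {q \<in> {..<n}. (v p, v q) \<in> parcs G} = out_arcs (with_proj G) (v p)"
        by (fastforce simp: out_arcs_def)
    qed
    then have "(\<Sum>q<n. if (v p, v q) \<in> parcs G then 1 else 0 :: real) = real (out_degree (with_proj G) (v p))"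
      by (simp add: out_degree_def bij_betw_same_card flip: sum.inter_filter)
    moreover have "out_degree (with_proj G) (v p) \<le> max_degree G"
      unfolding max_degree_def using pair_finite_verts p ran by (intro Max_ge) auto
    ultimately show ?thesis
      by simp
  qed
  \<comment> \<open>The covers form a finite nonempty family, so the minimum in
    \<open>vertex_cover_number\<close> is attained by some \<open>T\<close>.\<close>
  have "finite {T. vertex_cover G T}"
    using pair_finite_verts by (rule finite_subset[rotated, OF finite_Pow_iff[THEN iffD2]]) (auto simp: vertex_cover_def)
  moreover have "vertex_cover G (pverts G)"
    using in_arcsD1 by (auto simp: vertex_cover_def)
  ultimately have "vertex_cover_number G \<in> card ` {T. vertex_cover G T}"
    unfolding vertex_cover_number_def by (intro Min_in) auto
  then obtain T where T: "vertex_cover G T" and card_T: "card T = vertex_cover_number G"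
    by auto
  \<comment> \<open>The minimum cover is pulled back to matrix indices; injectivity of
    \<open>v\<close> preserves its size.\<close>
  define S where "S = {p \<in> {..<n}. v p \<in> T}"
  have "v ` S = T"
    using T ran by (auto simp: S_def vertex_cover_def)
  moreover have "inj_on v S"
    using inj by (rule inj_on_subset) (auto simp: S_def)
  ultimately have card_S: "card S = vertex_cover_number G"
    using card_T card_image by fastforce
  have "(\<Sum>\<mu>\<in>spectrum ?A. real (order \<mu> (char_poly ?A)) * cmod \<mu>)
      \<le> 2 * real (card S) * sqrt (real (max_degree G))"
  proof (rule energy_le_cover)
    show "?A \<in> carrier_mat n n"
      by (simp add: gain_adjacency_def)
    show "S \<subseteq> {..<n}"
      by (auto simp: S_def)
    show "p \<in> S \<or> q \<in> S" if "p < n" "q < n" "?A $$ (p, q) \<noteq> 0" for p q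
      using that T by (auto simp: gain_adjacency_def S_def vertex_cover_def split: if_splits)
    show "(\<Sum>q<n. (cmod (?A $$ (p, q)))\<^sup>2) \<le> real (max_degree G)" if "p < n" for p
      using deg[OF that] that by (simp add: norm_A)
    \<comment> \<open>Symmetry of the arcs gives column \<open>q\<close> the same nonzero positions
      as row \<open>q\<close>, so the degree bound for rows applies.\<close>
    show "(\<Sum>p<n. (cmod (?A $$ (p, q)))\<^sup>2) \<le> real (max_degree G)" if "q < n" for q
      using deg[OF that] that by (simp add: norm_A arc_sym[of "v q"])
  qed
  then show ?thesis
    by (simp add: gain_energy_def Let_def card_S)
qed

end
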